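(* Let $f:\mathbb R\to\mathbb R$ be $C^1$ and let $\mathcal G=\{G(t)\}_{t\in\mathbb Z^+}$ be a sequence of stochastic $m\times m$ matrices. Suppose that the uncoupled system $s(t+1)=f(s(t))$ has a compact asymptotically stable attractor $A\subset\mathbb R$ (as defined in the context), with Lyapunov exponent $$\mu=\sup_{s_0\in A}\limsup_{t\to\infty}\frac1t\sum_{k=0}^{t-1}\log|f'(s(k))|,\qquad s(k)=f^{(k)}(s_0).$$ If $\operatorname{diam}(\mathcal G)\,e^{\mu}<1$, then the coupled system $$x^i(t+1)=\sum_{j=1}^m G_{ij}(t)f(x^j(t)),\qquad i=1,\dots,m,\ t\in\mathbb Z^+,$$ is synchronized.
   Context: $\mathbb Z^+=\{0,1,2,\dots\}$. A stochastic matrix is a square matrix with nonnegative entries and all row sums equal to $1$. Asymptotically stable attractor for $s(t+1)=f(s(t))$: a compact set $A\subset\mathbb R$ such that (i) $A$ is forward invariant; (ii) for any neighborhood $U$ of $A$ there is a neighborhood $V$ of $A$ with $f^{n}(V)\subset U$ for all $n\in\mathbb Z^+$ ($f^n=f^{(n)}$ is the $n$-th iterate); (iii) for any sufficiently small neighborhood $U$ of $A$, $f^n(U)$ converges to $A$: for any neighborhood $V$ of $A$ there is $n_0$ with $f^n(U)\subset V$ for $n\ge n_0$; (iv) there is $s^*\in A$ whose $\omega$-limit set is $A$. Hajnal diameter: for a real matrix $L$ with rows $g_1,\dots,g_m$ and a fixed vector norm, $\operatorname{diam}(L)=\max_{i,j}\|g_i-g_j\|$; for a column vector $x$ this is $\max_{i,j}|x^i-x^j|$.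 With the left product $\prod_{k=a}^bA_k=A_b\cdots A_a$, $$\operatorname{diam}(\mathcal G)=\limsup_{t\to\infty}\sup_{t_0\ge0}\Big(\operatorname{diam}\prod_{k=t_0}^{t_0+t-1}G(k)\Big)^{1/t}$$ (independent of the norm). Synchronized (uniformly locally completely): there exists $\eta>0$ such that for any $\epsilon>0$ there exists $T>0$ such that $\operatorname{diam}([x^1(t),\dots,x^m(t)]^\top)\le\epsilon$ for all $t_0\ge0$, all $t>t_0+T$, and all solutions whose initial components $x^i(t_0)$, $i=1,\dots,m$, lie in the $\eta$-neighborhood of the value $s(t_0)\in A$ of a synchronized state $s(t)$ (a solution of $s(t+1)=f(s(t))$). *)

theory Defs
  imports "HOL-Analysis.Analysis"
begin

definition stochastic_matrix :: "real ^ 'm ^ 'm \<Rightarrow> bool" where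
  "stochastic_matrix L \<longleftrightarrow> (\<forall>i j. 0 \<le> L $ i $ j) \<and> (\<forall>i. (\<Sum>j\<in>UNIV. L $ i $ j) = 1)"

definition set_nbhd :: "'a::topological_space set \<Rightarrow> 'a set \<Rightarrow> bool" where
  "set_nbhd U A \<longleftrightarrow> A \<subseteq> interior U"

definition omega_limit :: "(real \<Rightarrow> real) \<Rightarrow> real \<Rightarrow> real set" where
  "omega_limit f s = {y. \<exists>r::nat \<Rightarrow> nat. strict_mono r \<and> (\<lambda>n. (f ^^ r n) s) \<longlonglongrightarrow> y}"

definition asymp_stable_attractor :: "(real \<Rightarrow> real) \<Rightarrow> real set \<Rightarrow> bool" where
  "asymp_stable_attractor f A \<longleftrightarrow>
     compact A \<and>
     f ` A \<subseteq> A \<and>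
     (\<forall>U. set_nbhd U A \<longrightarrow> (\<exists>V. set_nbhd V A \<and> (\<forall>n. (f ^^ n) ` V \<subseteq> U))) \<and>
     (\<exists>W. set_nbhd W A \<and>
        (\<forall>U. set_nbhd U A \<and> U \<subseteq> W \<longrightarrow>
           (\<forall>V. set_nbhd V A \<longrightarrow> (\<exists>n0. \<forall>n\<ge>n0. (f ^^ n) ` U \<subseteq> V)))) \<and>
     (\<exists>s\<in>A. omega_limit f s = A)"

text \<open>
  The orbit may pass through critical points of \<open>f\<close>, where \<open>log 0 = -\<infinity>\<close>; the library convention
  \<open>ln 0 = 0\<close> would be wrong here. Logarithm, Lyapunov exponent and exponential are therefore
  extended-real-valued, with \<open>exp (-\<infinity>) = 0\<close>.
\<close>

definition elog :: "real \<Rightarrow> ereal" where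
  "elog r = (if r = 0 then -\<infinity> else ereal (ln r))"

definition eexp :: "ereal \<Rightarrow> ereal" where
  "eexp a = (case a of ereal r \<Rightarrow> ereal (exp r) | PInfty \<Rightarrow> \<infinity> | MInfty \<Rightarrow> 0)"

definition lyapunov_exponent :: "(real \<Rightarrow> real) \<Rightarrow> real set \<Rightarrow> ereal" where
  "lyapunov_exponent f A =
     (SUP s0\<in>A. limsup (\<lambda>t. (\<Sum>k<t. elog \<bar>deriv f ((f ^^ k) s0)\<bar>) / ereal (real t)))"

definition vector_norm :: "('a::real_vector \<Rightarrow> real) \<Rightarrow> bool" where
  "vector_norm N \<longleftrightarrow>
     (\<forall>v. 0 \<le> N v) \<and> (\<forall>v. N v = 0 \<longleftrightarrow> v = 0) \<and>
     (\<forall>c v. N (c *\<^sub>R v) = \<bar>c\<bar> * N v) \<and>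
     (\<forall>v w. N (v + w) \<le> N v + N w)"

definition matrix_diam :: "(real ^ 'n \<Rightarrow> real) \<Rightarrow> real ^ 'n ^ 'm \<Rightarrow> real" where
  "matrix_diam N L = Max {N (row i L - row j L) | i j. True}"

definition vec_diam :: "real ^ 'm \<Rightarrow> real" where
  "vec_diam x = Max {\<bar>x $ i - x $ j\<bar> | i j. True}"

text \<open>\<open>left_prod G a t\<close> is \<open>G (a + t - 1) ** \<dots> ** G a\<close>, later matrices multiplying from the left.\<close>

primrec left_prod :: "(nat \<Rightarrow> real ^ 'm ^ 'm) \<Rightarrow> nat \<Rightarrow> nat \<Rightarrow> real ^ 'm ^ 'm" where
  "left_prod G a 0 = mat 1"
| "left_prod G a (Suc t) = G (a + t) ** left_prod G a t"

text \<open>The value at \<open>t = 0\<close> is irrelevant for the upper limit.\<close>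

definition hajnal_diam :: "(real ^ 'm \<Rightarrow> real) \<Rightarrow> (nat \<Rightarrow> real ^ 'm ^ 'm) \<Rightarrow> ereal" where
  "hajnal_diam N G =
     limsup (\<lambda>t. SUP t0. ereal (matrix_diam N (left_prod G t0 t) powr (1 / real t)))"

definition uncoupled_solution :: "(real \<Rightarrow> real) \<Rightarrow> nat \<Rightarrow> (nat \<Rightarrow> real) \<Rightarrow> bool" where
  "uncoupled_solution f t0 s \<longleftrightarrow> (\<forall>t\<ge>t0. s (Suc t) = f (s t))"

definition coupled_solution ::
  "(real \<Rightarrow> real) \<Rightarrow> (nat \<Rightarrow> real ^ 'm ^ 'm) \<Rightarrow> nat \<Rightarrow> (nat \<Rightarrow> real ^ 'm) \<Rightarrow> bool" where
  "coupled_solution f G t0 x \<longleftrightarrow>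
     (\<forall>t\<ge>t0. \<forall>i. x (Suc t) $ i = (\<Sum>j\<in>UNIV. G t $ i $ j * f (x t $ j)))"

definition synchronized ::
  "(real \<Rightarrow> real) \<Rightarrow> (nat \<Rightarrow> real ^ 'm ^ 'm) \<Rightarrow> real set \<Rightarrow> bool" where
  "synchronized f G A \<longleftrightarrow>
     (\<exists>\<eta>>(0::real). \<forall>\<epsilon>>(0::real). \<exists>T>(0::nat). \<forall>t0 s x.
        uncoupled_solution f t0 s \<and> s t0 \<in> A \<and>
        coupled_solution f G t0 x \<and> (\<forall>i. \<bar>x t0 $ i - s t0\<bar> < \<eta>) \<longrightarrow>
        (\<forall>t>t0 + T. vec_diam (x t) \<le> \<epsilon>))"

end

theory Submission
  imports Defs
begin

text \<open>
  Choose reals \<open>g\<close> above the Hajnal diameter and \<open>l\<close> above \<open>e\<^sup>\<mu>\<close> with \<open>g l < 1\<close>. By compactness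
  the derivative of the \<open>n\<close>-th iterate is at most \<open>C l\<^sup>n\<close> on a whole neighbourhood of the
  attractor. Linearizing a block of \<open>T\<close> steps around the uncoupled orbit of one component, the scalar
  derivatives commute with the matrices, so the block multiplies the diameter by at most
  \<open>const (g l)\<^sup>T\<close> plus a small error. The reference orbit has to be restarted after each block, since
  orbits in the attractor may be unstable; the restarts form a pseudo-orbit, which stays near the
  attractor because for large \<open>T\<close> the map \<open>f\<^sup>T\<close> sends a neighbourhood well inside itself.
\<close>

section \<open>Stochastic matrices, arbitrary norms and Hajnal diameters\<close>

section \<open>Stochastic matrices and diameters\<close>

lemma stochastic_matrix_mat_1: "stochastic_matrix (mat 1 :: real ^ 'm ^ 'm)"
  by (auto simp: stochastic_matrix_def mat_def)

lemma stochastic_matrix_mult: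
  assumes "stochastic_matrix L" "stochastic_matrix M"
  shows "stochastic_matrix (L ** M)"
proof -
  have "(\<Sum>j\<in>UNIV. (L ** M) $ i $ j) = 1" for i
  proof -
    have "(\<Sum>j\<in>UNIV. (L ** M) $ i $ j) = (\<Sum>k\<in>UNIV. \<Sum>j\<in>UNIV. L $ i $ k * M $ k $ j)"
      unfolding matrix_matrix_mult_def by simp (rule sum.swap)
    also have "\<dots> = (\<Sum>k\<in>UNIV. L $ i $ k * (\<Sum>j\<in>UNIV. M $ k $ j))"
      by (simp add: sum_distrib_left)
    also have "\<dots> = 1"
      using assms by (simp add: stochastic_matrix_def)
    finally show ?thesis .
  qed
  then show ?thesis
    using assms by (auto simp: stochastic_matrix_def matrix_matrix_mult_def intro!: sum_nonneg)
qed

lemma stochastic_matrix_left_prod: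
  assumes "\<And>t. stochastic_matrix (G t)"
  shows "stochastic_matrix (left_prod G a t)"
  by (induction t) (auto intro: stochastic_matrix_mat_1 stochastic_matrix_mult assms)

text \<open>Each entry of \<open>L *v z\<close> is a convex combination of entries of
  \<open>z\<close>, so stochastic matrices never expand the maximum norm. Errors therefore pass
  through every coupling step without growing.\<close>

lemma stochastic_matrix_mult_vec_bound:
  assumes "stochastic_matrix L" "\<And>j. \<bar>z $ j\<bar> \<le> d"
  shows "\<bar>(L *v z) $ i\<bar> \<le> d"
proof -
  have "\<bar>(L *v z) $ i\<bar> \<le> (\<Sum>j\<in>UNIV. \<bar>L $ i $ j * z $ j\<bar>)"
    unfolding matrix_vector_mult_def by simp
  also have "\<dots> \<le> (\<Sum>j\<in>UNIV. L $ i $ j * d)"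
    using assms by (intro sum_mono) (auto simp: stochastic_matrix_def abs_mult intro: mult_left_mono)
  also have "\<dots> = d"
    using assms(1) by (simp add: stochastic_matrix_def flip: sum_distrib_right)
  finally show ?thesis .
qed

lemma vector_norm_upper_bound:
  fixes N :: "real ^ 'm \<Rightarrow> real"
  assumes "vector_norm N"
  shows "\<exists>K>0. \<forall>v. N v \<le> K * norm v"
proof -
  have tri: "N (v + w) \<le> N v + N w" and hom: "N (c *\<^sub>R v) = \<bar>c\<bar> * N v"
    and nn: "0 \<le> N v" and zero: "N 0 = 0" for v w c
    using assms by (auto simp: vector_norm_def)
  have sum: "N (\<Sum>i\<in>I. g i) \<le> (\<Sum>i\<in>I. N (g i))" for I :: "'m set" and g
    by (induction I rule: infinite_finite_induct) (auto simp: zero intro: order_trans[OF tri])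
  define K where "K = (\<Sum>i\<in>UNIV. N (axis i 1 :: real ^ 'm))"
  have "N v \<le> (K + 1) * norm v" for v
  proof -
    have "N v = N (\<Sum>i\<in>UNIV. (v $ i) *\<^sub>R axis i 1)"
      using basis_expansion[of v] by (simp add: scalar_mult_eq_scaleR)
    also have "\<dots> \<le> (\<Sum>i\<in>UNIV. \<bar>v $ i\<bar> * N (axis i 1))"
      using sum[of "\<lambda>i. (v $ i) *\<^sub>R axis i 1" UNIV] by (simp add: hom)
    also have "\<dots> \<le> (\<Sum>i\<in>UNIV. norm v * N (axis i 1))"
      by (intro sum_mono mult_right_mono component_le_norm_cart nn)
    also have "\<dots> = K * norm v"
      by (simp add: K_def sum_distrib_left mult.commute)
    \<comment> \<open>Passing from \<open>K\<close> to \<open>K + 1\<close> makes the constant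
      positive once \<open>K\<close> is nonnegative.\<close>
    finally show ?thesis
      by (simp add: distrib_right add_increasing2)
  qed
  moreover have "0 \<le> K"
    unfolding K_def by (intro sum_nonneg nn)
  ultimately show ?thesis
    by (intro exI[of _ "K + 1"]) auto
qed

text \<open>The upper bound makes \<open>N\<close> Lipschitz for the Euclidean norm, so
  \<open>N\<close> attains a positive minimum on the compact unit sphere; homogeneity carries this
  to all vectors.\<close>

lemma vector_norm_lower_bound:
  fixes N :: "real ^ 'm \<Rightarrow> real"
  assumes "vector_norm N"
  shows "\<exists>K>0. \<forall>v. norm v \<le> K * N v"
proof -
  have tri: "N (v + w) \<le> N v + N w" and hom: "N (c *\<^sub>R v) = \<bar>c\<bar> * N v"
    and nn: "0 \<le> N v" and zero: "N v = 0 \<longleftrightarrow> v = 0" for v w c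
    using assms by (auto simp: vector_norm_def)
  obtain K where K: "K > 0" "\<And>v. N v \<le> K * norm v"
    using vector_norm_upper_bound[OF assms] by blast
  have "K-lipschitz_on UNIV N"
  proof (rule lipschitz_onI)
    fix v w
    have "N v \<le> N w + N (v - w)" "N w \<le> N v + N (w - v)"
      using tri[of w "v - w"] tri[of v "w - v"] by auto
    then show "dist (N v) (N w) \<le> K * dist v w"
      using K(2)[of "v - w"] K(2)[of "w - v"] by (auto simp: dist_norm abs_if norm_minus_commute)
  qed (use K in auto)
  then have cont: "continuous_on (sphere 0 1) N"
    by (meson lipschitz_on_continuous_on continuous_on_subset subset_UNIV)
  \<comment> \<open>\<open>undefined\<close> is merely some index; its unit vector shows that the
    sphere is nonempty.\<close>
  have "(axis undefined 1 :: real ^ 'm) \<in> sphere 0 1"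
    by simp
  then obtain w where w: "w \<in> sphere 0 1" "\<And>v. v \<in> sphere 0 1 \<Longrightarrow> N w \<le> N v"
    using continuous_attains_inf[OF compact_sphere _ cont] by blast
  have "w \<noteq> 0"
    using w(1) by auto
  then have pos: "N w > 0"
    using nn[of w] zero[of w] by linarith
  have "norm v \<le> (1 / N w) * N v" for v
  proof (cases "v = 0")
    case False
    then have "N w \<le> N ((1 / norm v) *\<^sub>R v)"
      by (intro w) simp
    also have "\<dots> = N v / norm v"
      by (simp add: hom)
    finally show ?thesis
      using False pos by (simp add: field_simps)
  qed (use zero[of 0] in simp)
  then show ?thesis
    using pos by (intro exI[of _ "1 / N w"]) auto
qed

lemma matrix_diam_ge:
  fixes L :: "real ^ 'n ^ 'm"
  shows "N (row i L - row j L) \<le> matrix_diam N L"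
proof -
  have "finite {N (row i L - row j L) | i j. True}"
    by (rule finite_subset[of _ "(\<lambda>(i, j). N (row i L - row j L)) ` UNIV"]) auto
  then show ?thesis
    unfolding matrix_diam_def by (intro Max_ge) auto
qed

lemma matrix_diam_le:
  fixes L :: "real ^ 'n ^ 'm"
  assumes "\<And>i j. N (row i L - row j L) \<le> b"
  shows "matrix_diam N L \<le> b"
proof -
  have "finite {N (row i L - row j L) | i j. True}"
    by (rule finite_subset[of _ "(\<lambda>(i, j). N (row i L - row j L)) ` UNIV"]) auto
  then show ?thesis
    unfolding matrix_diam_def using assms by (subst Max_le_iff) auto
qed

lemma vec_diam_le:
  fixes x :: "real ^ 'm"
  assumes "\<And>i j. \<bar>x $ i - x $ j\<bar> \<le> b"
  shows "vec_diam x \<le> b"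
proof -
  have "finite {\<bar>x $ i - x $ j\<bar> | i j. True}"
    by (rule finite_subset[of _ "(\<lambda>(i, j). \<bar>x $ i - x $ j\<bar>) ` UNIV"]) auto
  then show ?thesis
    unfolding vec_diam_def using assms by (subst Max_le_iff) auto
qed

lemma matrix_diam_nonneg:
  fixes L :: "real ^ 'n ^ 'm"
  assumes "vector_norm N"
  shows "0 \<le> matrix_diam N L"
  using matrix_diam_ge[of N undefined L undefined] assms
  by (auto simp: vector_norm_def dest: order_trans)

lemma norm_le_card_mult:
  fixes z :: "real ^ 'm" and d :: real
  assumes "\<And>j. \<bar>z $ j\<bar> \<le> d"
  shows "norm z \<le> CARD('m) * d"
  using order_trans[OF norm_le_l1_cart sum_bounded_above[of UNIV "\<lambda>j. \<bar>z $ j\<bar>" d]] assms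
  by auto

text \<open>Entries lie between 0 and 1, so row differences are bounded entrywise. The common bound
  over all stochastic matrices later makes the Hajnal diameter finite.\<close>

lemma matrix_diam_stochastic_bounded:
  fixes N :: "real ^ 'm \<Rightarrow> real"
  assumes "vector_norm N"
  shows "\<exists>B\<ge>1. \<forall>L :: real ^ 'm ^ 'm. stochastic_matrix L \<longrightarrow> matrix_diam N L \<le> B"
proof -
  obtain K where K: "K > 0" "\<And>v. N v \<le> K * norm v"
    using vector_norm_upper_bound[OF assms] by blast
  have "matrix_diam N L \<le> max 1 (K * CARD('m))" if L: "stochastic_matrix L" for L :: "real ^ 'm ^ 'm"
  proof (rule matrix_diam_le)
    fix i j
    have entry: "0 \<le> L $ a $ b \<and> L $ a $ b \<le> 1" for a b
      using L member_le_sum[of b UNIV "\<lambda>b. L $ a $ b"] by (auto simp: stochastic_matrix_def)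
    have "\<bar>(row i L - row j L) $ k\<bar> \<le> 1" for k
      using entry[of i k] entry[of j k] by (simp add: row_def abs_le_iff)
    then have "norm (row i L - row j L) \<le> CARD('m)"
      using norm_le_card_mult[of "row i L - row j L" 1] by simp
    then have "N (row i L - row j L) \<le> K * CARD('m)"
      using K(2)[of "row i L - row j L"] K(1) mult_left_mono[of "norm (row i L - row j L)" "CARD('m)" K]
      by linarith
    then show "N (row i L - row j L) \<le> max 1 (K * CARD('m))"
      by simp
  qed
  then show ?thesis
    by (intro exI[of _ "max 1 (K * CARD('m))"]) auto
qed

text \<open>The difference of two entries of \<open>L *v z\<close> is the inner product of a row
  difference with \<open>z\<close>; Cauchy-Schwarz and the comparison of norms do the rest.
  \<open>K\<close> depends on \<open>N\<close> and the dimension only, hence serves all matrix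
  products at once.\<close>

lemma matrix_diam_mult_vec:
  fixes N :: "real ^ 'm \<Rightarrow> real"
  assumes "vector_norm N"
  shows "\<exists>K>0. \<forall>(L :: real ^ 'm ^ 'm) z d i j. (\<forall>k. \<bar>z $ k\<bar> \<le> d) \<longrightarrow>
           \<bar>(L *v z) $ i - (L *v z) $ j\<bar> \<le> K * matrix_diam N L * d"
proof -
  obtain K where K: "K > 0" "\<And>v. norm v \<le> K * N v"
    using vector_norm_lower_bound[OF assms] by blast
  have "\<bar>(L *v z) $ i - (L *v z) $ j\<bar> \<le> (K * CARD('m)) * matrix_diam N L * d"
    if z: "\<forall>k. \<bar>z $ k\<bar> \<le> d" for L :: "real ^ 'm ^ 'm" and z d i j
  proof -
    have "(L *v z) $ i - (L *v z) $ j = inner (row i L - row j L) z"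
      by (simp add: matrix_vector_mult_def inner_vec_def row_def sum_subtractf left_diff_distrib)
    then have "\<bar>(L *v z) $ i - (L *v z) $ j\<bar> \<le> norm (row i L - row j L) * norm z"
      using Cauchy_Schwarz_ineq2 by metis
    also have "\<dots> \<le> (K * matrix_diam N L) * (CARD('m) * d)"
    proof (intro mult_mono)
      show "norm (row i L - row j L) \<le> K * matrix_diam N L"
        using K matrix_diam_ge by (meson mult_left_mono order_trans less_imp_le)
      show "norm z \<le> CARD('m) * d"
        using z norm_le_card_mult by blast
      show "0 \<le> K * matrix_diam N L"
        using K(1) by (intro mult_nonneg_nonneg matrix_diam_nonneg assms) auto
    qed auto
    finally show ?thesis
      by (simp add: mult_ac)
  qed
  then show ?thesis
    using K(1) by (intro exI[of _ "K * CARD('m)"]) auto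
qed

section \<open>Chain rule and linearization of the coupled system\<close>

section \<open>Derivatives along orbits\<close>

text \<open>By the chain rule this is the derivative of \<open>f ^^ n\<close> at \<open>y\<close>
  for differentiable \<open>f\<close>. The product form splits orbits without differentiating
  iterates.\<close>

definition orbit_deriv :: "(real \<Rightarrow> real) \<Rightarrow> nat \<Rightarrow> real \<Rightarrow> real" where
  "orbit_deriv f n y = (\<Prod>k<n. deriv f ((f ^^ k) y))"

lemma orbit_deriv_0 [simp]: "orbit_deriv f 0 y = 1"
  by (simp add: orbit_deriv_def)

lemma orbit_deriv_Suc: "orbit_deriv f (Suc n) y = deriv f ((f ^^ n) y) * orbit_deriv f n y"
  by (simp add: orbit_deriv_def)

lemma orbit_deriv_add: "orbit_deriv f (m + n) y = orbit_deriv f m y * orbit_deriv f n ((f ^^ m) y)"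
proof (induction n)
  case (Suc n)
  have "(f ^^ (m + n)) y = (f ^^ n) ((f ^^ m) y)"
    by (metis funpow_add o_apply add.commute)
  then show ?case
    by (simp add: orbit_deriv_Suc Suc)
qed simp

lemma orbit_deriv_le_power:
  assumes "\<And>k. k < n \<Longrightarrow> \<bar>deriv f ((f ^^ k) y)\<bar> \<le> D"
  shows "\<bar>orbit_deriv f n y\<bar> \<le> D ^ n"
  unfolding orbit_deriv_def abs_prod
  using prod_mono[of "{..<n}" "\<lambda>k. \<bar>deriv f ((f ^^ k) y)\<bar>" "\<lambda>_. D"] assms by auto

lemma C1_UNIV_derivD:
  fixes f :: "real \<Rightarrow> real"
  assumes "f C1_differentiable_on UNIV"
  shows "(f has_real_derivative deriv f x) (at x)" "continuous_on UNIV (deriv f)"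
proof -
  obtain D where D: "\<And>x. (f has_vector_derivative D x) (at x)" "continuous_on UNIV D"
    using assms unfolding C1_differentiable_on_def by auto
  then have D': "(f has_real_derivative D x) (at x)" for x
    by (simp add: has_real_derivative_iff_has_vector_derivative)
  then have "deriv f = D"
    by (auto intro: DERIV_imp_deriv)
  then show "(f has_real_derivative deriv f x) (at x)" "continuous_on UNIV (deriv f)"
    using D D' by auto
qed

lemma C1_UNIV_continuous_on:
  fixes f :: "real \<Rightarrow> real"
  assumes "f C1_differentiable_on UNIV"
  shows "continuous_on UNIV f"
  using C1_UNIV_derivD(1)[OF assms] by (meson DERIV_continuous_on has_field_derivative_at_within)

lemma continuous_on_funpow:
  fixes f :: "'a::topological_space \<Rightarrow> 'a"
  assumes "continuous_on UNIV f"
  shows "continuous_on UNIV (f ^^ n)"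
proof (induction n)
  case (Suc n)
  then show ?case
    using continuous_on_compose[OF Suc continuous_on_subset[OF assms]] by auto
qed (simp add: id_def)

lemma continuous_on_orbit_deriv:
  assumes "f C1_differentiable_on UNIV"
  shows "continuous_on UNIV (orbit_deriv f n)"
  unfolding orbit_deriv_def
  by (intro continuous_on_prod continuous_on_compose2[OF C1_UNIV_derivD(2)[OF assms]]
      continuous_on_funpow C1_UNIV_continuous_on assms) auto

text \<open>The bound is taken at least 1 so that its powers increase with the exponent.\<close>

lemma deriv_bounded_interval:
  assumes "f C1_differentiable_on UNIV"
  shows "\<exists>D\<ge>1. \<forall>y. \<bar>y\<bar> \<le> R \<longrightarrow> \<bar>deriv f y\<bar> \<le> D"
proof -
  have "bounded (deriv f ` {-R..R})"
    by (intro compact_imp_bounded compact_continuous_image continuous_on_subset[OF C1_UNIV_derivD(2)[OF assms]]) auto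
  then obtain B where "\<forall>y\<in>{-R..R}. \<bar>deriv f y\<bar> \<le> B"
    unfolding bounded_iff by auto
  then show ?thesis
    by (intro exI[of _ "max 1 B"]) (auto simp: abs_le_iff le_max_iff_disj)
qed

text \<open>The derivative is uniformly continuous on a compact interval, and the mean value
  estimate then gives a linearization error that is uniform in the base point.\<close>

lemma uniform_linearization:
  assumes f: "f C1_differentiable_on UNIV" and "\<epsilon> > 0"
  shows "\<exists>\<delta>>0. \<forall>u h. \<bar>u\<bar> \<le> R \<and> \<bar>h\<bar> \<le> \<delta> \<longrightarrow> \<bar>f (u + h) - f u - deriv f u * h\<bar> \<le> \<epsilon> * \<bar>h\<bar>"
proof -
  \<comment> \<open>The margin 1 keeps \<open>u + h\<close> inside the interval when
    \<open>\<bar>h\<bar> \<le> 1\<close>.\<close>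
  define I where "I = {-R - 1..R + 1}"
  have "uniformly_continuous_on I (deriv f)"
    unfolding I_def
    by (intro compact_uniformly_continuous continuous_on_subset[OF C1_UNIV_derivD(2)[OF f]]) auto
  then obtain \<delta> where \<delta>: "\<delta> > 0" "\<And>u v. u \<in> I \<Longrightarrow> v \<in> I \<Longrightarrow> dist v u < \<delta> \<Longrightarrow> dist (deriv f v) (deriv f u) < \<epsilon>"
    using \<open>\<epsilon> > 0\<close> unfolding uniformly_continuous_on_def by metis
  have "\<bar>f (u + h) - f u - deriv f u * h\<bar> \<le> \<epsilon> * \<bar>h\<bar>"
    if u: "\<bar>u\<bar> \<le> R" and h: "\<bar>h\<bar> \<le> min (\<delta> / 2) 1" for u h
  proof -
    define S where "S = {u - \<bar>h\<bar>..u + \<bar>h\<bar>}"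
    \<comment> \<open>Subtracting the linear part leaves a function whose derivative is below
      \<open>\<epsilon>\<close> near \<open>u\<close>.\<close>
    define g where "g = (\<lambda>v. f v - deriv f u * v)"
    have "norm (g (u + h) - g u) \<le> \<epsilon> * norm (u + h - u)"
    proof (rule field_differentiable_bound[of S g "\<lambda>v. deriv f v - deriv f u"])
      fix v assume v: "v \<in> S"
      have "((\<lambda>v. f v - deriv f u * v) has_real_derivative deriv f v - deriv f u) (at v within S)"
        using has_field_derivative_at_within[OF C1_UNIV_derivD(1)[OF f], of v S]
        by (auto intro!: derivative_eq_intros)
      then show "(g has_field_derivative deriv f v - deriv f u) (at v within S)"
        by (simp add: g_def)
      have "dist v u < \<delta>" "v \<in> I" "u \<in> I"
        using v u h \<delta>(1) by (auto simp: S_def I_def dist_real_def)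
      then show "norm (deriv f v - deriv f u) \<le> \<epsilon>"
        using \<delta>(2)[of u v] by (simp add: dist_norm)
    qed (auto simp: S_def)
    then show ?thesis
      by (simp add: g_def algebra_simps)
  qed
  then show ?thesis
    using \<delta>(1) by (intro exI[of _ "min (\<delta> / 2) 1"]) auto
qed

text \<open>All components are linearized at the same point of the orbit of \<open>u\<close>, so
  each step contributes one scalar derivative times a matrix; the scalars collect into
  \<open>orbit_deriv\<close> and the matrices into \<open>left_prod\<close>. The threshold may
  depend on \<open>n\<close>, but not on the starting time, the solution or
  \<open>u\<close>.\<close>

lemma coupled_linearization:
  fixes G :: "nat \<Rightarrow> real ^ 'm ^ 'm"
  assumes f: "f C1_differentiable_on UNIV"
    and G: "\<And>t. stochastic_matrix (G t)"
    and "\<epsilon> > 0"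
  shows "\<exists>\<delta>>0. \<forall>t0 x u d. coupled_solution f G t0 x \<and> (\<forall>k. \<bar>(f ^^ k) u\<bar> \<le> R) \<and>
           d \<le> \<delta> \<and> (\<forall>i. \<bar>x t0 $ i - u\<bar> \<le> d) \<longrightarrow>
           (\<forall>i. \<bar>x (t0 + n) $ i - (f ^^ n) u
                  - orbit_deriv f n u * (left_prod G t0 n *v (\<chi> j. x t0 $ j - u)) $ i\<bar> \<le> \<epsilon> * d)"
  using \<open>\<epsilon> > 0\<close>
proof (induction n arbitrary: \<epsilon>)
  case 0
  have "0 \<le> \<epsilon> * d" if "\<forall>i. \<bar>x t0 $ i - u\<bar> \<le> d" for x :: "nat \<Rightarrow> real ^ 'm" and t0 u d
    using that 0 order_trans[OF abs_ge_zero] by (metis mult_nonneg_nonneg less_imp_le)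
  then show ?case
    by (intro exI[of _ 1]) auto
next
  case (Suc n)
  obtain D where D: "D \<ge> 1" "\<And>y. \<bar>y\<bar> \<le> R \<Longrightarrow> \<bar>deriv f y\<bar> \<le> D"
    using deriv_bounded_interval[OF f] by blast
  \<comment> \<open>The error budget is halved: \<open>\<epsilon>1\<close> bounds the old error,
    amplified by at most \<open>D\<close>, and \<open>\<epsilon>2\<close> the new linearization
    error. The minimum with 1 keeps the deviation after \<open>n\<close> steps below
    \<open>(D ^ n + 1) * d\<close>.\<close>
  define \<epsilon>1 where "\<epsilon>1 = min 1 (\<epsilon> / (2 * D))"
  define \<epsilon>2 where "\<epsilon>2 = \<epsilon> / (2 * (D ^ n + 1))"
  have Dn: "D ^ n + 1 > 0"
    using D(1) by (smt (verit) zero_less_power)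
  have \<epsilon>1: "\<epsilon>1 > 0" "\<epsilon>1 \<le> 1" "D * \<epsilon>1 \<le> \<epsilon> / 2" and \<epsilon>2: "\<epsilon>2 > 0" "\<epsilon>2 * (D ^ n + 1) = \<epsilon> / 2"
    using Suc.prems D(1) Dn unfolding \<epsilon>1_def \<epsilon>2_def by (auto simp: min_def field_simps)
  obtain \<delta>1 where \<delta>1: "\<delta>1 > 0"
    "\<And>t0 x u d i. coupled_solution f G t0 x \<Longrightarrow> (\<And>k. \<bar>(f ^^ k) u\<bar> \<le> R) \<Longrightarrow> d \<le> \<delta>1 \<Longrightarrow>
       (\<And>i. \<bar>x t0 $ i - u\<bar> \<le> d) \<Longrightarrow>
       \<bar>x (t0 + n) $ i - (f ^^ n) u
          - orbit_deriv f n u * (left_prod G t0 n *v (\<chi> j. x t0 $ j - u)) $ i\<bar> \<le> \<epsilon>1 * d"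
    using Suc.IH[OF \<epsilon>1(1)] by blast
  obtain \<delta>2 where \<delta>2: "\<delta>2 > 0"
    "\<And>v h. \<bar>v\<bar> \<le> R \<Longrightarrow> \<bar>h\<bar> \<le> \<delta>2 \<Longrightarrow> \<bar>f (v + h) - f v - deriv f v * h\<bar> \<le> \<epsilon>2 * \<bar>h\<bar>"
    using uniform_linearization[OF f \<epsilon>2(1)] by blast
  \<comment> \<open>Dividing by \<open>D ^ n + 1\<close> keeps the deviation after \<open>n\<close>
    steps within reach of the one-step linearization.\<close>
  define \<delta> where "\<delta> = min \<delta>1 (\<delta>2 / (D ^ n + 1))"
  have "\<delta> > 0"
    using \<delta>1(1) \<delta>2(1) Dn by (simp add: \<delta>_def)
  moreover have "\<bar>x (t0 + Suc n) $ i - (f ^^ Suc n) u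
      - orbit_deriv f (Suc n) u * (left_prod G t0 (Suc n) *v (\<chi> j. x t0 $ j - u)) $ i\<bar> \<le> \<epsilon> * d"
    if x: "coupled_solution f G t0 x" and u: "\<And>k. \<bar>(f ^^ k) u\<bar> \<le> R" and d: "d \<le> \<delta>"
      and xu: "\<And>i. \<bar>x t0 $ i - u\<bar> \<le> d" for t0 x u d i
  proof -
    define v where "v = (f ^^ n) u"
    define P where "P = orbit_deriv f n u"
    define w where "w = left_prod G t0 n *v (\<chi> j. x t0 $ j - u)"
    define z where "z = (\<chi> j. x (t0 + n) $ j - v)"
    \<comment> \<open>This is the error before averaging with \<open>G (t0 + n)\<close>; it suffices
      to bound it entrywise.\<close>
    define r where "r = (\<chi> j. f (x (t0 + n) $ j) - f v - deriv f v * P * w $ j)"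
    have "0 \<le> d"
      using xu[of i] by linarith
    have P: "\<bar>P\<bar> \<le> D ^ n"
      unfolding P_def using D(2) u by (intro orbit_deriv_le_power) auto
    have w: "\<bar>w $ j\<bar> \<le> d" for j
      unfolding w_def using xu by (intro stochastic_matrix_mult_vec_bound stochastic_matrix_left_prod G) auto
    have zr: "\<bar>z $ j - P * w $ j\<bar> \<le> \<epsilon>1 * d" for j
      using \<delta>1(2)[OF x u _ xu, of j] d by (simp add: \<delta>_def z_def v_def P_def w_def)
    have zb: "\<bar>z $ j\<bar> \<le> (D ^ n + 1) * d" for j
    proof -
      have "\<bar>P * w $ j\<bar> \<le> D ^ n * d"
        unfolding abs_mult using P w[of j] D(1) by (intro mult_mono) auto
      moreover have "\<epsilon>1 * d \<le> 1 * d"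
        using \<epsilon>1 \<open>0 \<le> d\<close> by (intro mult_right_mono) auto
      ultimately show ?thesis
        using zr[of j] by (simp add: distrib_right)
    qed
    have "\<bar>r $ j\<bar> \<le> \<epsilon> * d" for j
    proof -
      have "(D ^ n + 1) * d \<le> \<delta>2"
        using d Dn by (simp add: \<delta>_def pos_le_divide_eq mult.commute)
      then have "\<bar>f (v + z $ j) - f v - deriv f v * z $ j\<bar> \<le> \<epsilon>2 * \<bar>z $ j\<bar>"
        using zb[of j] u[of n] by (intro \<delta>2(2)) (auto simp: v_def)
      also have "\<dots> \<le> \<epsilon>2 * ((D ^ n + 1) * d)"
        using zb \<epsilon>2(1) by (intro mult_left_mono) auto
      finally have 1: "\<bar>f (v + z $ j) - f v - deriv f v * z $ j\<bar> \<le> \<epsilon> / 2 * d"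
        using \<epsilon>2(2) by (simp add: mult.assoc[symmetric])
      have "\<bar>deriv f v * (z $ j - P * w $ j)\<bar> \<le> D * (\<epsilon>1 * d)"
        unfolding abs_mult using D u[of n] zr[of j] by (intro mult_mono) (auto simp: v_def)
      also have "\<dots> \<le> \<epsilon> / 2 * d"
        using \<epsilon>1(3) \<open>0 \<le> d\<close> by (simp only: mult.assoc[symmetric] mult_right_mono)
      finally have 2: "\<bar>deriv f v * (z $ j - P * w $ j)\<bar> \<le> \<epsilon> / 2 * d" .
      \<comment> \<open>New linearization error plus the old error multiplied by the
        derivative.\<close>
      have "r $ j = (f (v + z $ j) - f v - deriv f v * z $ j) + deriv f v * (z $ j - P * w $ j)"
        by (simp add: r_def z_def algebra_simps)
      then show ?thesis
        using 1 2 by linarith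
    qed
    then have "\<bar>(G (t0 + n) *v r) $ i\<bar> \<le> \<epsilon> * d"
      by (intro stochastic_matrix_mult_vec_bound G)
    \<comment> \<open>Row sums equal to 1 reproduce the reference value \<open>f v\<close>, and the
      scalar derivative factors out of the average.\<close>
    moreover have "(G (t0 + n) *v r) $ i = x (t0 + Suc n) $ i - (f ^^ Suc n) u
      - orbit_deriv f (Suc n) u * (left_prod G t0 (Suc n) *v (\<chi> j. x t0 $ j - u)) $ i"
    proof -
      have step: "x (t0 + Suc n) $ i = (\<Sum>j\<in>UNIV. G (t0 + n) $ i $ j * f (x (t0 + n) $ j))"
        using x by (simp add: coupled_solution_def)
      have row: "(\<Sum>j\<in>UNIV. G (t0 + n) $ i $ j) = 1"
        using G by (simp add: stochastic_matrix_def)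
      have "(left_prod G t0 (Suc n) *v (\<chi> j. x t0 $ j - u)) $ i = (\<Sum>j\<in>UNIV. G (t0 + n) $ i $ j * w $ j)"
        by (simp add: w_def matrix_vector_mul_assoc[symmetric]) (simp add: matrix_vector_mult_def)
      then have "orbit_deriv f (Suc n) u * (left_prod G t0 (Suc n) *v (\<chi> j. x t0 $ j - u)) $ i
          = (\<Sum>j\<in>UNIV. G (t0 + n) $ i $ j * (deriv f v * P * w $ j))"
        by (simp add: orbit_deriv_Suc v_def P_def sum_distrib_left mult_ac)
      moreover have "(f ^^ Suc n) u = (\<Sum>j\<in>UNIV. G (t0 + n) $ i $ j * f v)"
        by (simp add: v_def row flip: sum_distrib_right)
      moreover have "(G (t0 + n) *v r) $ i = (\<Sum>j\<in>UNIV. G (t0 + n) $ i $ j * f (x (t0 + n) $ j))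
          - (\<Sum>j\<in>UNIV. G (t0 + n) $ i $ j * f v)
          - (\<Sum>j\<in>UNIV. G (t0 + n) $ i $ j * (deriv f v * P * w $ j))"
        by (simp add: r_def matrix_vector_mult_def right_diff_distrib sum_subtractf)
      ultimately show ?thesis
        using step by linarith
    qed
    ultimately show ?thesis
      by simp
  qed
  ultimately show ?case
    by blast
qed

section \<open>From upper limits to geometric bounds\<close>

section \<open>Exponential bounds from the Lyapunov exponent and the Hajnal diameter\<close>

lemma elog_abs_le:
  assumes "\<bar>r\<bar> \<le> D" "1 \<le> D"
  shows "elog \<bar>r\<bar> \<le> ereal (ln D)"
  using assms by (auto simp: elog_def)

lemma sum_elog_abs:
  fixes a :: "'a \<Rightarrow> real"
  assumes "finite I" "\<And>k. k \<in> I \<Longrightarrow> a k \<noteq> 0"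
  shows "(\<Sum>k\<in>I. elog \<bar>a k\<bar>) = ereal (ln \<bar>\<Prod>k\<in>I. a k\<bar>)"
proof -
  have "(\<Sum>k\<in>I. elog \<bar>a k\<bar>) = (\<Sum>k\<in>I. ereal (ln \<bar>a k\<bar>))"
    using assms by (intro sum.cong) (auto simp: elog_def)
  then show ?thesis
    using assms by (simp add: abs_prod ln_prod)
qed

lemma lyapunov_exponent_less_infinity:
  assumes "\<And>s k. s \<in> A \<Longrightarrow> \<bar>deriv f ((f ^^ k) s)\<bar> \<le> D" "1 \<le> D"
  shows "lyapunov_exponent f A < \<infinity>"
proof -
  have "limsup (\<lambda>t. (\<Sum>k<t. elog \<bar>deriv f ((f ^^ k) s)\<bar>) / ereal (real t)) \<le> ereal (ln D)"
    if s: "s \<in> A" for s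
  proof (intro Limsup_bounded eventually_mono[OF eventually_gt_at_top[of 0]])
    fix t :: nat assume t: "t > 0"
    have "(\<Sum>k<t. elog \<bar>deriv f ((f ^^ k) s)\<bar>) \<le> (\<Sum>k<t. ereal (ln D))"
      using assms s by (intro sum_mono elog_abs_le) auto
    also have "\<dots> = ereal (t * ln D)"
      by simp
    finally have "(\<Sum>k<t. elog \<bar>deriv f ((f ^^ k) s)\<bar>) / ereal t \<le> ereal (t * ln D) / ereal t"
      using t by (intro ereal_divide_right_mono) auto
    then show "(\<Sum>k<t. elog \<bar>deriv f ((f ^^ k) s)\<bar>) / ereal t \<le> ereal (ln D)"
      using t by simp
  qed
  then have "lyapunov_exponent f A \<le> ereal (ln D)"
    unfolding lyapunov_exponent_def by (intro SUP_least)
  then show ?thesis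
    by (rule order.strict_trans1) simp
qed

lemma eexp_nonneg: "0 \<le> eexp a"
  by (cases a) (auto simp: eexp_def)

text \<open>This includes the exponent \<open>-\<infinity>\<close>, where both sides are
  true.\<close>

lemma eexp_less_iff:
  assumes "0 < r"
  shows "eexp a < ereal r \<longleftrightarrow> a < ereal (ln r)"
  using assms by (cases a) (auto simp: eexp_def ln_less_cancel_iff[symmetric] simp del: ln_less_cancel_iff)

text \<open>The time averages of the logarithms are eventually below \<open>ln l\<close>;
  multiplying by the time and exponentiating gives the bound.\<close>

lemma orbit_deriv_less_power:
  assumes "eexp (lyapunov_exponent f A) < ereal l" "s \<in> A" "0 < l"
  shows "\<exists>n>0. \<bar>orbit_deriv f n s\<bar> < l ^ n"
proof -
  have "limsup (\<lambda>t. (\<Sum>k<t. elog \<bar>deriv f ((f ^^ k) s)\<bar>) / ereal (real t)) \<le> lyapunov_exponent f A"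
    unfolding lyapunov_exponent_def using assms(2) by (rule SUP_upper)
  also have "\<dots> < ereal (ln l)"
    using assms by (simp add: eexp_less_iff)
  finally have "eventually (\<lambda>t. (\<Sum>k<t. elog \<bar>deriv f ((f ^^ k) s)\<bar>) / ereal (real t) < ereal (ln l)) sequentially"
    by (rule Limsup_lessD)
  then have "eventually (\<lambda>t. 0 < t \<and> (\<Sum>k<t. elog \<bar>deriv f ((f ^^ k) s)\<bar>) / ereal (real t) < ereal (ln l)) sequentially"
    by (intro eventually_conj eventually_gt_at_top)
  then have "\<exists>t. 0 < t \<and> (\<Sum>k<t. elog \<bar>deriv f ((f ^^ k) s)\<bar>) / ereal (real t) < ereal (ln l)"
    by (rule eventually_happens'[OF sequentially_bot])
  then obtain t where t: "0 < t" "(\<Sum>k<t. elog \<bar>deriv f ((f ^^ k) s)\<bar>) / ereal (real t) < ereal (ln l)"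
    by blast
  have "\<bar>orbit_deriv f t s\<bar> < l ^ t"
  \<comment> \<open>If the orbit meets a critical point the product vanishes and the bound is
    trivial; otherwise the sum is a real logarithm.\<close>
  proof (cases "orbit_deriv f t s = 0")
    case False
    then have "ereal (ln \<bar>orbit_deriv f t s\<bar>) / ereal t < ereal (ln l)"
      using t(2) unfolding orbit_deriv_def by (subst (asm) sum_elog_abs) auto
    then have "ln \<bar>orbit_deriv f t s\<bar> < t * ln l"
      using t(1) by (simp add: field_simps)
    then have "ln \<bar>orbit_deriv f t s\<bar> < ln (l ^ t)"
      using assms(3) by (simp add: ln_realpow)
    then show ?thesis
      using False assms(3) by simp
  qed (use assms(3) in simp)
  then show ?thesis
    using t(1) by blast
qed

text \<open>A common bound \<open>B \<ge> 1\<close> on the diameters also bounds their roots,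
  uniformly in the starting time.\<close>

lemma hajnal_diam_bounds:
  fixes G :: "nat \<Rightarrow> real ^ 'm ^ 'm"
  assumes "\<And>t. stochastic_matrix (G t)" "vector_norm N"
  shows "0 \<le> hajnal_diam N G" "hajnal_diam N G < \<infinity>"
proof -
  obtain B where B: "B \<ge> 1" "\<And>L :: real ^ 'm ^ 'm. stochastic_matrix L \<Longrightarrow> matrix_diam N L \<le> B"
    using matrix_diam_stochastic_bounded[OF assms(2)] by blast
  have "(SUP t0. ereal (matrix_diam N (left_prod G t0 t) powr (1 / real t))) \<le> ereal B"
    if "t > 0" for t
  proof (intro SUP_least)
    fix t0
    have "matrix_diam N (left_prod G t0 t) powr (1 / real t) \<le> B powr (1 / real t)"
      by (intro powr_mono2 matrix_diam_nonneg B stochastic_matrix_left_prod assms) auto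
    also have "\<dots> \<le> B powr 1"
      using that B(1) by (intro powr_mono) auto
    finally show "ereal (matrix_diam N (left_prod G t0 t) powr (1 / real t)) \<le> ereal B"
      using B(1) by simp
  qed
  then have "hajnal_diam N G \<le> ereal B"
    unfolding hajnal_diam_def
    by (intro Limsup_bounded eventually_mono[OF eventually_gt_at_top[of 0]])
  then show "hajnal_diam N G < \<infinity>"
    by (rule order.strict_trans1) simp
  show "0 \<le> hajnal_diam N G"
    unfolding hajnal_diam_def
    by (intro le_Limsup always_eventually allI SUP_upper2[of 0]) auto
qed

text \<open>The supremum over \<open>t0\<close> sits inside the upper limit, so one threshold serves
  all starting times.\<close>

lemma matrix_diam_le_power:
  fixes G :: "nat \<Rightarrow> real ^ 'm ^ 'm"
  assumes "vector_norm N" "hajnal_diam N G < ereal g" "0 < g"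
  shows "\<exists>T1. \<forall>t\<ge>T1. \<forall>t0. matrix_diam N (left_prod G t0 t) \<le> g ^ t"
proof -
  have "eventually (\<lambda>t. (SUP t0. ereal (matrix_diam N (left_prod G t0 t) powr (1 / real t))) < ereal g) sequentially"
    using assms(2) unfolding hajnal_diam_def by (rule Limsup_lessD)
  then obtain T1 where T1: "\<And>t. t \<ge> T1 \<Longrightarrow> (SUP t0. ereal (matrix_diam N (left_prod G t0 t) powr (1 / real t))) < ereal g"
    by (auto simp: eventually_sequentially)
  \<comment> \<open>The lower bound 1 on \<open>t\<close> is needed to undo the root: at
    \<open>t = 0\<close> the exponent \<open>1 / real t\<close> is 0.\<close>
  have "matrix_diam N (left_prod G t0 t) \<le> g ^ t" if t: "t \<ge> max 1 T1" for t t0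
  proof -
    define m where "m = matrix_diam N (left_prod G t0 t)"
    have "ereal (m powr (1 / real t)) < ereal g"
      unfolding m_def by (rule order.strict_trans1[OF SUP_upper T1]) (use t in auto)
    then have "(m powr (1 / real t)) powr real t \<le> g powr real t"
      by (intro powr_mono2) auto
    moreover have "0 \<le> m"
      unfolding m_def by (rule matrix_diam_nonneg[OF assms(1)])
    ultimately show ?thesis
      using t assms(3) by (simp add: powr_powr powr_realpow m_def)
  qed
  then show ?thesis
    by blast
qed

text \<open>Both factors are finite and nonnegative, so by continuity they can be raised slightly
  with the product staying below 1. Finiteness matters because
  \<open>0 * \<infinity> = 0\<close>.\<close>

lemma ereal_mult_less_one_room:
  fixes h e :: ereal
  assumes "h * e < 1" "0 \<le> h" "h < \<infinity>" "0 \<le> e" "e < \<infinity>"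
  shows "\<exists>g l. 0 < g \<and> 0 < l \<and> h < ereal g \<and> e < ereal l \<and> g * l < 1"
proof -
  obtain a b where ab: "h = ereal a" "e = ereal b" "0 \<le> a" "0 \<le> b" "a * b < 1"
    using assms by (cases h; cases e) (auto simp: one_ereal_def)
  have "((\<lambda>x. (a + x) * (b + x)) \<longlongrightarrow> (a + 0) * (b + 0)) (at_right 0)"
    by (intro tendsto_intros)
  then have "eventually (\<lambda>x. (a + x) * (b + x) < 1) (at_right 0)"
    using ab(5) by (intro order_tendstoD(2)) auto
  then have "eventually (\<lambda>x. (a + x) * (b + x) < 1 \<and> x > 0) (at_right (0::real))"
    by (intro eventually_conj eventually_at_right_less)
  then have "\<exists>x. (a + x) * (b + x) < 1 \<and> x > 0"
    by (rule eventually_happens'[OF trivial_limit_at_right_real])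
  then obtain x where "(a + x) * (b + x) < 1" "x > 0"
    by blast
  then show ?thesis
    using ab by (intro exI[of _ "a + x"] exI[of _ "b + x"]) auto
qed

text \<open>
  The chain rule lets a pointwise bound with point-dependent times \<open>n\<close> be concatenated along any
  orbit that never leaves the neighbourhood; compactness makes those times bounded.
\<close>

lemma orbit_deriv_uniform_bound:
  assumes f: "f C1_differentiable_on UNIV" and A: "compact A" and l: "0 < l"
    and less: "\<And>s. s \<in> A \<Longrightarrow> \<exists>n>0. \<bar>orbit_deriv f n s\<bar> < l ^ n"
  shows "\<exists>V C. open V \<and> bounded V \<and> A \<subseteq> V \<and>
           (\<forall>y. (\<forall>k. (f ^^ k) y \<in> V) \<longrightarrow> (\<forall>n. \<bar>orbit_deriv f n y\<bar> \<le> C * l ^ n))"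
proof -
  define O' where "O' = (\<lambda>n. {y. \<bar>orbit_deriv f n y\<bar> < l ^ n})"
  have "open (O' n)" for n
    unfolding O'_def
    by (intro open_Collect_less continuous_intros continuous_on_orbit_deriv f)
  moreover have "A \<subseteq> (\<Union>n\<in>{0<..}. O' n)"
    using less by (auto simp: O'_def)
  ultimately obtain J where J: "J \<subseteq> {0<..}" "finite J" "A \<subseteq> (\<Union>n\<in>J. O' n)"
    using compactE_image[OF A, of "{0<..}" O'] by metis
  obtain M where M: "\<And>n. n \<in> J \<Longrightarrow> n \<le> M"
    using finite_nat_set_iff_bounded_le J(2) by auto
  obtain R where R: "A \<subseteq> ball 0 R"
    using A compact_imp_bounded bounded_subset_ballD by blast
  \<comment> \<open>The ball makes \<open>V\<close> bounded and puts the derivative bound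
    \<open>D\<close> at disposal on it.\<close>
  define V where "V = (\<Union>n\<in>J. O' n) \<inter> ball 0 R"
  have V: "open V" "A \<subseteq> V" "bounded V"
    unfolding V_def using \<open>\<And>n. open (O' n)\<close> J(3) R bounded_Int bounded_ball by auto
  obtain D where D: "D \<ge> 1" "\<And>y. \<bar>y\<bar> \<le> R \<Longrightarrow> \<bar>deriv f y\<bar> \<le> D"
    using deriv_bounded_interval[OF f] by blast
  \<comment> \<open>After peeling off good blocks fewer than \<open>M\<close> steps remain, each
    costing at most a factor \<open>max 1 (D / l)\<close> relative to \<open>l\<close>.\<close>
  define C where "C = (max 1 (D / l)) ^ M"
  have "\<bar>orbit_deriv f n y\<bar> \<le> C * l ^ n" if "\<forall>k. (f ^^ k) y \<in> V" for y n
    using that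
  proof (induction n arbitrary: y rule: less_induct)
    case (less n)
    show ?case
    proof (cases "n < M")
      case True
      have "\<bar>orbit_deriv f n y\<bar> \<le> D ^ n"
        using less.prems by (intro orbit_deriv_le_power D(2)) (auto simp: V_def dist_real_def less_imp_le)
      also have "\<dots> = (D / l) ^ n * l ^ n"
        using l by (simp add: power_divide)
      also have "(D / l) ^ n \<le> max 1 (D / l) ^ n"
        using D(1) l by (intro power_mono) auto
      also have "\<dots> \<le> C"
        unfolding C_def using True by (intro power_increasing) auto
      finally show ?thesis
        using l by simp
    next
      case False
      \<comment> \<open>Membership of the starting point selects a block length \<open>j\<close>. It
        is positive, so the recursion descends, and at most \<open>M\<close>, so the block fits into
        \<open>n\<close>.\<close>
      have "(f ^^ 0) y \<in> V"
        using less.prems by blast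
      then obtain j where j: "j \<in> J" "\<bar>orbit_deriv f j y\<bar> < l ^ j"
        by (auto simp: V_def O'_def)
      then have "0 < j" "j \<le> n"
        using J(1) M False by fastforce+
      have "\<forall>k. (f ^^ k) ((f ^^ j) y) \<in> V"
        using less.prems by (metis funpow_add o_apply)
      then have IH: "\<bar>orbit_deriv f (n - j) ((f ^^ j) y)\<bar> \<le> C * l ^ (n - j)"
        using \<open>0 < j\<close> \<open>j \<le> n\<close> by (intro less.IH) auto
      have "\<bar>orbit_deriv f n y\<bar> = \<bar>orbit_deriv f j y\<bar> * \<bar>orbit_deriv f (n - j) ((f ^^ j) y)\<bar>"
        using orbit_deriv_add[of f j "n - j" y] \<open>j \<le> n\<close> by (simp add: abs_mult)
      also have "\<dots> \<le> l ^ j * (C * l ^ (n - j))"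
        using j IH l by (intro mult_mono) auto
      also have "\<dots> = C * l ^ n"
        using \<open>j \<le> n\<close> power_add[of l j "n - j"] by (simp add: mult.left_commute)
      finally show ?thesis .
    qed
  qed
  then show ?thesis
    using V by blast
qed

section \<open>Pseudo-orbits near the attractor and block contraction\<close>

section \<open>Absorbing neighbourhoods and contraction\<close>

text \<open>Stability confines the orbits to \<open>V0\<close>, and attraction sends
  \<open>V\<close> into a thinner tube around \<open>A\<close>. The margin \<rho> leaves room to
  move the reference point after each block.\<close>

lemma attractor_absorbing_nbhd:
  assumes att: "asymp_stable_attractor f A" and V0: "open V0" "A \<subseteq> V0"
  shows "\<exists>V \<rho> n0. 0 < \<rho> \<and> (\<forall>a\<in>A. ball a \<rho> \<subseteq> V) \<and> (\<forall>y\<in>V. \<forall>k. (f ^^ k) y \<in> V0) \<and>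
           (\<forall>n\<ge>n0. \<forall>y\<in>V. ball ((f ^^ n) y) \<rho> \<subseteq> V)"
proof -
  have "set_nbhd V0 A"
    using V0 by (simp add: set_nbhd_def interior_open)
  then obtain V1 where V1: "set_nbhd V1 A" "\<And>n. (f ^^ n) ` V1 \<subseteq> V0"
    using att unfolding asymp_stable_attractor_def by metis
  obtain W where W: "set_nbhd W A"
    "\<And>U V. set_nbhd U A \<Longrightarrow> U \<subseteq> W \<Longrightarrow> set_nbhd V A \<Longrightarrow> \<exists>n0. \<forall>n\<ge>n0. (f ^^ n) ` U \<subseteq> V"
    using att unfolding asymp_stable_attractor_def by metis
  \<comment> \<open>\<open>V1\<close> gives confinement, \<open>W\<close> makes the attraction
    condition applicable, and the interiors make the intersection open.\<close>
  define V where "V = interior V1 \<inter> interior W"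
  have V: "open V" "A \<subseteq> V" "V \<subseteq> V1" "V \<subseteq> W"
    using V1(1) W(1) interior_subset by (auto simp: V_def set_nbhd_def)
  have "compact A"
    using att by (simp add: asymp_stable_attractor_def)
  then obtain e where e: "e > 0" "(\<Union>a\<in>A. ball a e) \<subseteq> V"
    using compact_subset_open_imp_ball_epsilon_subset V(1,2) by metis
  \<comment> \<open>Half the radius leaves a margin \<open>e / 2\<close> inside the tube of radius
    \<open>e\<close>.\<close>
  define V' where "V' = (\<Union>a\<in>A. ball a (e / 2))"
  have "A \<subseteq> V'" "open V'"
    using e(1) by (auto simp: V'_def)
  then obtain n0 where n0: "\<And>n. n \<ge> n0 \<Longrightarrow> (f ^^ n) ` V \<subseteq> V'"
    using W(2)[of V V'] V by (auto simp: set_nbhd_def interior_open)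
  have "ball v (e / 2) \<subseteq> V" if v: "v \<in> V'" for v
  proof
    fix w assume "w \<in> ball v (e / 2)"
    then obtain a where "a \<in> A" "dist a v < e / 2" "dist v w < e / 2"
      using v by (auto simp: V'_def)
    then have "w \<in> ball a e"
      using dist_triangle[of a w v] by simp
    then show "w \<in> V"
      using e(2) \<open>a \<in> A\<close> by blast
  qed
  then have "\<forall>n\<ge>n0. \<forall>y\<in>V. ball ((f ^^ n) y) (e / 2) \<subseteq> V"
    using n0 by blast
  moreover have "\<forall>a\<in>A. ball a (e / 2) \<subseteq> V"
    using \<open>\<And>v. v \<in> V' \<Longrightarrow> ball v (e / 2) \<subseteq> V\<close> \<open>A \<subseteq> V'\<close> by blast
  moreover have "\<forall>y\<in>V. \<forall>k. (f ^^ k) y \<in> V0"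
    using V(3) V1(2) by blast
  ultimately show ?thesis
    using e(1) by (intro exI[of _ V] exI[of _ "e / 2"] exI[of _ n0]) auto
qed

lemma coupled_solution_later:
  assumes "coupled_solution f G t0 x" "t0 \<le> t1"
  shows "coupled_solution f G t1 x"
  using assms by (auto simp: coupled_solution_def)

text \<open>The linear part has spread at most \<open>d / 4\<close>, and each of the two compared
  components adds an error of at most \<open>d / 8\<close>, which makes
  \<open>d / 2\<close>.\<close>

lemma coupled_block_contraction:
  fixes G :: "nat \<Rightarrow> real ^ 'm ^ 'm"
  assumes f: "f C1_differentiable_on UNIV"
    and G: "\<And>t. stochastic_matrix (G t)"
    and V: "\<And>u k. u \<in> V \<Longrightarrow> \<bar>(f ^^ k) u\<bar> \<le> R"
    and contr: "\<And>u t0 z d i j. u \<in> V \<Longrightarrow> (\<And>k. \<bar>z $ k\<bar> \<le> d) \<Longrightarrow>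
       \<bar>orbit_deriv f T u\<bar> * \<bar>(left_prod G t0 T *v z) $ i - (left_prod G t0 T *v z) $ j\<bar> \<le> d / 4"
  shows "\<exists>M \<delta>. 0 < M \<and> 0 < \<delta> \<and> (\<forall>t0 x u d. coupled_solution f G t0 x \<and> u \<in> V \<and> d \<le> \<delta> \<and>
           (\<forall>i. \<bar>x t0 $ i - u\<bar> \<le> d) \<longrightarrow>
           (\<forall>r\<le>T. \<forall>i. \<bar>x (t0 + r) $ i - (f ^^ r) u\<bar> \<le> M * d) \<and>
           (\<forall>i j. \<bar>x (t0 + T) $ i - x (t0 + T) $ j\<bar> \<le> d / 2))"
proof -
  obtain D where D: "D \<ge> 1" "\<And>y. \<bar>y\<bar> \<le> R \<Longrightarrow> \<bar>deriv f y\<bar> \<le> D"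
    using deriv_bounded_interval[OF f] by blast
  \<comment> \<open>\<open>D ^ T\<close> covers the linear growth within a block, and the extra 1
    the linearization error.\<close>
  define M where "M = D ^ T + 1"
  have "\<forall>n. \<exists>\<delta>>0. \<forall>t0 x u d. coupled_solution f G t0 x \<and> (\<forall>k. \<bar>(f ^^ k) u\<bar> \<le> R) \<and>
           d \<le> \<delta> \<and> (\<forall>i. \<bar>x t0 $ i - u\<bar> \<le> d) \<longrightarrow>
           (\<forall>i. \<bar>x (t0 + n) $ i - (f ^^ n) u
                  - orbit_deriv f n u * (left_prod G t0 n *v (\<chi> j. x t0 $ j - u)) $ i\<bar> \<le> 1 / 8 * d)"
    using coupled_linearization[OF f G, where \<epsilon> = "1 / 8" and R = R] by simp
  then obtain \<Delta> where \<Delta>: "\<And>n. \<Delta> n > 0"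
    "\<And>n t0 x u d i. coupled_solution f G t0 x \<Longrightarrow> (\<And>k. \<bar>(f ^^ k) u\<bar> \<le> R) \<Longrightarrow>
           d \<le> \<Delta> n \<Longrightarrow> (\<And>i. \<bar>x t0 $ i - u\<bar> \<le> d) \<Longrightarrow>
           \<bar>x (t0 + n) $ i - (f ^^ n) u
                  - orbit_deriv f n u * (left_prod G t0 n *v (\<chi> j. x t0 $ j - u)) $ i\<bar> \<le> 1 / 8 * d"
    by metis
  \<comment> \<open>The thresholds depend on the number of steps; their minimum controls all times
    of the block.\<close>
  define \<delta> where "\<delta> = Min (\<Delta> ` {..T})"
  have \<delta>: "\<delta> > 0" "\<And>r. r \<le> T \<Longrightarrow> \<delta> \<le> \<Delta> r"
    using \<Delta>(1) by (auto simp: \<delta>_def)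
  have "0 < M"
    using D(1) by (auto simp: M_def intro: add_nonneg_pos)
  moreover have "\<bar>x (t0 + r) $ i - (f ^^ r) u\<bar> \<le> M * d"
    "\<bar>x (t0 + T) $ i - x (t0 + T) $ j\<bar> \<le> d / 2"
    if x: "coupled_solution f G t0 x" and u: "u \<in> V" and d: "d \<le> \<delta>"
      and xu: "\<And>i. \<bar>x t0 $ i - u\<bar> \<le> d" and r: "r \<le> T" for t0 x u d r i j
  proof -
    define w where "w = (\<lambda>n. left_prod G t0 n *v (\<chi> j. x t0 $ j - u))"
    have err: "\<bar>x (t0 + n) $ i - (f ^^ n) u - orbit_deriv f n u * w n $ i\<bar> \<le> 1 / 8 * d" if "n \<le> T" for n i
      unfolding w_def using \<Delta>(2)[OF x V[OF u] _ xu] \<delta>(2)[OF that] d by (meson order_trans)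
    have "0 \<le> d"
      using xu[of i] by linarith
    have "\<bar>orbit_deriv f r u\<bar> \<le> D ^ r"
      using V[OF u] by (intro orbit_deriv_le_power D(2)) auto
    also have "\<dots> \<le> D ^ T"
      using D(1) r by (intro power_increasing) auto
    finally have P: "\<bar>orbit_deriv f r u\<bar> \<le> D ^ T" .
    have "\<bar>w r $ i\<bar> \<le> d"
      unfolding w_def using xu by (intro stochastic_matrix_mult_vec_bound stochastic_matrix_left_prod G) auto
    then have "\<bar>orbit_deriv f r u * w r $ i\<bar> \<le> D ^ T * d"
      unfolding abs_mult using P D(1) by (intro mult_mono) auto
    then show "\<bar>x (t0 + r) $ i - (f ^^ r) u\<bar> \<le> M * d"
      using err[OF r, of i] \<open>0 \<le> d\<close> unfolding M_def distrib_right by linarith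
    have "\<bar>orbit_deriv f T u * (w T $ i - w T $ j)\<bar> \<le> d / 4"
      unfolding w_def abs_mult using xu by (intro contr u) auto
    then show "\<bar>x (t0 + T) $ i - x (t0 + T) $ j\<bar> \<le> d / 2"
      using err[of T i] err[of T j] unfolding right_diff_distrib by linarith
  qed
  ultimately show ?thesis
    using \<delta>(1) by (intro exI[of _ M] exI[of _ \<delta>]) blast
qed

text \<open>Every \<open>T\<close> steps the reference point is reset to a fixed component of the
  solution. The distance bound halves per block, and the reset moves the reference by less than
  \<rho>, so \<open>absorb\<close> keeps it in \<open>V\<close>.\<close>

lemma synchronized_if_contracting_block:
  fixes G :: "nat \<Rightarrow> real ^ 'm ^ 'm"
  assumes "0 < T" "0 < \<rho>" "0 < M" "0 < \<delta>"
    and near: "\<And>a. a \<in> A \<Longrightarrow> ball a \<rho> \<subseteq> V"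
    and absorb: "\<And>y. y \<in> V \<Longrightarrow> ball ((f ^^ T) y) \<rho> \<subseteq> V"
    and dev: "\<And>t0 x u d r i. coupled_solution f G t0 x \<Longrightarrow> u \<in> V \<Longrightarrow> d \<le> \<delta> \<Longrightarrow>
           (\<And>i. \<bar>x t0 $ i - u\<bar> \<le> d) \<Longrightarrow> r \<le> T \<Longrightarrow> \<bar>x (t0 + r) $ i - (f ^^ r) u\<bar> \<le> M * d"
    and contr: "\<And>t0 x u d i j. coupled_solution f G t0 x \<Longrightarrow> u \<in> V \<Longrightarrow> d \<le> \<delta> \<Longrightarrow>
           (\<And>i. \<bar>x t0 $ i - u\<bar> \<le> d) \<Longrightarrow> \<bar>x (t0 + T) $ i - x (t0 + T) $ j\<bar> \<le> d / 2"
  shows "synchronized f G A"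
proof -
  \<comment> \<open>Chosen so that the deviation \<open>M * \<delta>'\<close> over one block is
    below the margin \<rho>.\<close>
  define \<delta>' where "\<delta>' = min \<delta> (\<rho> / (2 * M))"
  have \<delta>': "0 < \<delta>'" "\<delta>' \<le> \<delta>" "M * \<delta>' < \<rho>"
    using assms(2-4) by (auto simp: \<delta>'_def min_def field_simps)
  \<comment> \<open>The bound \<rho> places the first reference point in \<open>V\<close>; the half
    is needed because two components near \<open>s t0\<close> are compared with each other.\<close>
  define \<eta> where "\<eta> = min \<rho> (\<delta>' / 2)"
  have "0 < \<eta>"
    using \<delta>' assms(2) by (simp add: \<eta>_def)
  moreover have "\<exists>Ts>0. \<forall>t0 s x. uncoupled_solution f t0 s \<and> s t0 \<in> A \<and>
        coupled_solution f G t0 x \<and> (\<forall>i. \<bar>x t0 $ i - s t0\<bar> < \<eta>) \<longrightarrow>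
        (\<forall>t>t0 + Ts. vec_diam (x t) \<le> \<epsilon>)" if "\<epsilon> > 0" for \<epsilon>
  proof -
    \<comment> \<open>After \<open>q\<close> blocks every component is within
      \<open>\<epsilon> / 2\<close> of the reference orbit, hence the factor 2.\<close>
    obtain q where q: "(1 / 2) ^ q < \<epsilon> / (2 * M * \<delta>')"
      using real_arch_pow_inv[of "\<epsilon> / (2 * M * \<delta>')" "1 / 2"] \<open>\<epsilon> > 0\<close> \<delta>'(1) \<open>0 < M\<close> by auto
    have "vec_diam (x t) \<le> \<epsilon>"
      if s: "s t0 \<in> A" and x: "coupled_solution f G t0 x" and xs: "\<And>i. \<bar>x t0 $ i - s t0\<bar> < \<eta>"
        and t: "t > t0 + (q * T + 1)" for t0 s x t
    proof -
      \<comment> \<open>\<open>undefined\<close> serves as an arbitrary fixed component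
        index.\<close>
      define u where "u = (\<lambda>k. x (t0 + k * T) $ undefined)"
      have sol: "coupled_solution f G (t0 + n) x" for n
        using x coupled_solution_later by (metis le_add1)
      define d where "d = (\<lambda>k. (1 / 2) ^ k * \<delta>')"
      have d: "d k \<le> \<delta>'" "d 0 = \<delta>'" "d (Suc k) = d k / 2" "j \<le> k \<Longrightarrow> d k \<le> d j" for j k
        using \<delta>'(1) by (auto simp: d_def power_le_one intro!: mult_right_mono power_decreasing)
      \<comment> \<open>Invariant of the restarts: the reference stays in \<open>V\<close> and the
        distance bound is geometric.\<close>
      have inv: "u k \<in> V \<and> (\<forall>i. \<bar>x (t0 + k * T) $ i - u k\<bar> \<le> d k)" for k
      proof (induction k)
        case 0
        have "u 0 \<in> ball (s t0) \<rho>"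
          using xs[of undefined] by (simp add: u_def \<eta>_def dist_real_def abs_minus_commute)
        moreover have "\<bar>x t0 $ i - u 0\<bar> \<le> \<delta>'" for i
        proof -
          have "\<bar>x t0 $ j - s t0\<bar> < \<delta>' / 2" for j
            using xs[of j] by (simp add: \<eta>_def)
          from this[of i] this[of undefined] show ?thesis
            unfolding u_def mult_0 add_0_right by linarith
        qed
        ultimately show ?case
          using near[OF s] d(2) by auto
      next
        case (Suc k)
        have small: "d k \<le> \<delta>" "M * d k < \<rho>"
          using d(1)[of k] \<delta>' \<open>0 < M\<close> mult_left_mono[of "d k" \<delta>' M] by linarith+
        have eq: "t0 + Suc k * T = t0 + k * T + T"
          by simp
        have "\<bar>u (Suc k) - (f ^^ T) (u k)\<bar> < \<rho>"
          using dev[OF sol, of "u k" _ "k * T" T undefined] Suc small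
          unfolding u_def eq by (meson order_refl order.strict_trans1)
        then have "u (Suc k) \<in> V"
          using absorb[of "u k"] Suc by (auto simp: dist_real_def abs_minus_commute)
        moreover have "\<bar>x (t0 + Suc k * T) $ i - u (Suc k)\<bar> \<le> d (Suc k)" for i
          using contr[OF sol, of "u k" "d k" "k * T" i undefined] Suc small(1)
          unfolding u_def eq d(3) by simp
        ultimately show ?case
          by blast
      qed
      \<comment> \<open>The time is split into \<open>k \<ge> q\<close> complete blocks and a
        remainder, over which \<open>dev\<close> costs only the factor \<open>M\<close>.\<close>
      define k where "k = (t - t0) div T"
      define r where "r = (t - t0) mod T"
      have t_eq: "t = t0 + k * T + r"
        using t unfolding k_def r_def by simp
      have "r \<le> T"
        using \<open>0 < T\<close> by (simp add: r_def less_imp_le)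
      have "q * T div T \<le> (t - t0) div T"
        using t by (intro div_le_mono) simp
      then have "q \<le> k"
        using \<open>0 < T\<close> by (simp add: k_def)
      have "\<bar>x t $ i - (f ^^ r) (u k)\<bar> \<le> M * d k" for i
        unfolding t_eq using inv[of k] order_trans[OF d(1) \<delta>'(2)] \<open>r \<le> T\<close> by (intro dev sol) auto
      also have "M * d k \<le> M * d q"
        using d(4)[OF \<open>q \<le> k\<close>] \<open>0 < M\<close> by simp
      also have "\<dots> \<le> \<epsilon> / 2"
        using q \<delta>'(1) \<open>0 < M\<close> by (simp add: d_def field_simps)
      finally have half: "\<bar>x t $ i - (f ^^ r) (u k)\<bar> \<le> \<epsilon> / 2" for i .
      show ?thesis
      proof (rule vec_diam_le)
        fix i j
        show "\<bar>x t $ i - x t $ j\<bar> \<le> \<epsilon>"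
          using half[of i] half[of j] by linarith
      qed
    qed
    then show ?thesis
      \<comment> \<open>Adding 1 makes the waiting time positive also for
        \<open>q = 0\<close>.\<close>
      by (intro exI[of _ "q * T + 1"]) auto
  qed
  ultimately show ?thesis
    unfolding synchronized_def by blast
qed

section \<open>Choice of the constants and conclusion\<close>

theorem theorem2:
  fixes f :: "real \<Rightarrow> real"
    and G :: "nat \<Rightarrow> real ^ 'm ^ 'm"
    and A :: "real set"
    and N :: "real ^ 'm \<Rightarrow> real"
  assumes "f C1_differentiable_on UNIV"
    and "\<And>t. stochastic_matrix (G t)"
    and "asymp_stable_attractor f A"
    and "vector_norm N"
    and "hajnal_diam N G * eexp (lyapunov_exponent f A) < 1"
  shows "synchronized f G A"
proof -
  note f = assms(1) and G = assms(2) and att = assms(3) and N = assms(4)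
  have A: "compact A" "f ` A \<subseteq> A"
    using att by (auto simp: asymp_stable_attractor_def)
  have orbit: "(f ^^ k) s \<in> A" if "s \<in> A" for s k
    using that A(2) by (induction k) auto
  obtain RA where "\<And>s. s \<in> A \<Longrightarrow> \<bar>s\<bar> \<le> RA"
    using compact_imp_bounded[OF A(1)] by (auto simp: bounded_iff)
  then obtain D where "D \<ge> 1" "\<And>s. s \<in> A \<Longrightarrow> \<bar>deriv f s\<bar> \<le> D"
    using deriv_bounded_interval[OF f, of RA] by metis
  then have "lyapunov_exponent f A < \<infinity>"
    using orbit by (intro lyapunov_exponent_less_infinity) auto
  then have finite_exp: "eexp (lyapunov_exponent f A) < \<infinity>"
    by (cases "lyapunov_exponent f A") (auto simp: eexp_def)
  then obtain g l where gl: "0 < g" "0 < l" "hajnal_diam N G < ereal g"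
    "eexp (lyapunov_exponent f A) < ereal l" "g * l < 1"
    using ereal_mult_less_one_room[OF assms(5) hajnal_diam_bounds[OF G N] eexp_nonneg finite_exp]
    by blast

  \<comment> \<open>The constants \<open>C\<close> and \<open>K\<close> and the neighbourhoods are
    fixed before the block length \<open>T\<close>, so a large \<open>T\<close> can beat
    them.\<close>
  obtain V0 C where V0: "open V0" "bounded V0" "A \<subseteq> V0"
    "\<And>y n. (\<And>k. (f ^^ k) y \<in> V0) \<Longrightarrow> \<bar>orbit_deriv f n y\<bar> \<le> C * l ^ n"
    using orbit_deriv_uniform_bound[OF f A(1) gl(2) orbit_deriv_less_power[OF gl(4) _ gl(2)]] by metis
  obtain R where R: "\<And>y. y \<in> V0 \<Longrightarrow> \<bar>y\<bar> \<le> R"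
    using V0(2) by (auto simp: bounded_iff)
  obtain V \<rho> n0 where V: "0 < \<rho>" "\<And>a. a \<in> A \<Longrightarrow> ball a \<rho> \<subseteq> V" "\<And>y k. y \<in> V \<Longrightarrow> (f ^^ k) y \<in> V0"
    "\<And>n y. n \<ge> n0 \<Longrightarrow> y \<in> V \<Longrightarrow> ball ((f ^^ n) y) \<rho> \<subseteq> V"
    using attractor_absorbing_nbhd[OF att V0(1,3)] by metis
  obtain T1 where T1: "\<And>t t0. t \<ge> T1 \<Longrightarrow> matrix_diam N (left_prod G t0 t) \<le> g ^ t"
    using matrix_diam_le_power[OF N gl(3,1)] by blast
  obtain K where K: "K > 0" "\<And>(L :: real ^ 'm ^ 'm) z d i j. (\<And>k. \<bar>z $ k\<bar> \<le> d) \<Longrightarrow>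
           \<bar>(L *v z) $ i - (L *v z) $ j\<bar> \<le> K * matrix_diam N L * d"
    using matrix_diam_mult_vec[OF N] by metis

  \<comment> \<open>Since \<open>g * l < 1\<close>, geometric decay beats \<open>C * K\<close>; the
    same \<open>T\<close> can exceed the thresholds for absorption and for the matrix
    diameters.\<close>
  have "(\<lambda>t. C * K * (g * l) ^ t) \<longlonglongrightarrow> C * K * 0"
    using gl by (intro tendsto_intros LIMSEQ_power_zero) (simp add: abs_mult)
  then have "eventually (\<lambda>t. C * K * (g * l) ^ t < 1 / 4) sequentially"
    by (rule order_tendstoD) simp
  then have "eventually (\<lambda>t. C * K * (g * l) ^ t < 1 / 4 \<and> t \<ge> max 1 (max n0 T1)) sequentially"
    by (intro eventually_conj eventually_ge_at_top)
  then have "\<exists>T. C * K * (g * l) ^ T < 1 / 4 \<and> T \<ge> max 1 (max n0 T1)"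
    by (rule eventually_happens'[OF sequentially_bot])
  then obtain T where T: "C * K * (g * l) ^ T < 1 / 4" "T \<ge> 1" "T \<ge> n0" "T \<ge> T1"
    by auto

  \<comment> \<open>Orbits from \<open>V\<close> stay in \<open>V0\<close>, so the derivative
    contributes \<open>C * l ^ T\<close> and the matrix product \<open>K * g ^ T\<close>.\<close>
  have contr: "\<bar>orbit_deriv f T u\<bar> * \<bar>(left_prod G t0 T *v z) $ i - (left_prod G t0 T *v z) $ j\<bar> \<le> d / 4"
    if u: "u \<in> V" and z: "\<And>k. \<bar>z $ k\<bar> \<le> d" for u t0 z d i j
  proof -
    have "0 \<le> d"
      using z[of i] by linarith
    have P: "\<bar>orbit_deriv f T u\<bar> \<le> C * l ^ T"
      using V0(4) V(3)[OF u] by blast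
    have "\<bar>(left_prod G t0 T *v z) $ i - (left_prod G t0 T *v z) $ j\<bar> \<le> K * matrix_diam N (left_prod G t0 T) * d"
      using K(2) z by blast
    also have "\<dots> \<le> K * g ^ T * d"
      using K(1) T1[OF T(4)] \<open>0 \<le> d\<close> by (intro mult_right_mono mult_left_mono) auto
    finally have "\<bar>orbit_deriv f T u\<bar> * \<bar>(left_prod G t0 T *v z) $ i - (left_prod G t0 T *v z) $ j\<bar>
        \<le> (C * l ^ T) * (K * g ^ T * d)"
      using P by (intro mult_mono) auto
    also have "\<dots> = C * K * (g * l) ^ T * d"
      by (simp add: power_mult_distrib mult_ac)
    also have "\<dots> \<le> 1 / 4 * d"
      using T(1) \<open>0 \<le> d\<close> by (intro mult_right_mono) auto
    finally show ?thesis
      by simp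
  qed
  have "\<exists>M \<delta>. 0 < M \<and> 0 < \<delta> \<and> (\<forall>t0 x u d. coupled_solution f G t0 x \<and> u \<in> V \<and> d \<le> \<delta> \<and>
           (\<forall>i. \<bar>x t0 $ i - u\<bar> \<le> d) \<longrightarrow>
           (\<forall>r\<le>T. \<forall>i. \<bar>x (t0 + r) $ i - (f ^^ r) u\<bar> \<le> M * d) \<and>
           (\<forall>i j. \<bar>x (t0 + T) $ i - x (t0 + T) $ j\<bar> \<le> d / 2))"
    by (rule coupled_block_contraction[OF f G R[OF V(3)] contr])
  then obtain M \<delta> where M: "0 < M" "0 < \<delta>"
    and block: "\<forall>t0 x u d. coupled_solution f G t0 x \<and> u \<in> V \<and> d \<le> \<delta> \<and>
           (\<forall>i. \<bar>x t0 $ i - u\<bar> \<le> d) \<longrightarrow>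
           (\<forall>r\<le>T. \<forall>i. \<bar>x (t0 + r) $ i - (f ^^ r) u\<bar> \<le> M * d) \<and>
           (\<forall>i j. \<bar>x (t0 + T) $ i - x (t0 + T) $ j\<bar> \<le> d / 2)"
    by (elim exE conjE)
  show ?thesis
  proof (rule synchronized_if_contracting_block[of T \<rho> M \<delta>, OF _ V(1) M V(2) V(4)[OF T(3)]])
    show "0 < T"
      using T(2) by simp
  next
    fix t0 x u d r i
    assume "coupled_solution f G t0 x" "u \<in> V" "d \<le> \<delta>" "\<And>i. \<bar>x t0 $ i - u\<bar> \<le> d" "r \<le> T"
    then show "\<bar>x (t0 + r) $ i - (f ^^ r) u\<bar> \<le> M * d"
      using block[rule_format, of t0 x u d] by auto
  next
    fix t0 x u d i j
    assume "coupled_solution f G t0 x" "u \<in> V" "d \<le> \<delta>" "\<And>i. \<bar>x t0 $ i - u\<bar> \<le> d"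
    then show "\<bar>x (t0 + T) $ i - x (t0 + T) $ j\<bar> \<le> d / 2"
      using block[rule_format, of t0 x u d] by auto
  qed
qed

end
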